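(* Let $(\{A_n\}_{n},\{\Psi_n\}_{n})$ be an operator-valued p-ABS in $\mathcal{B}(\mathcal{X},\mathcal{Y})$. An operator-valued p-ABS $(\{B_n\}_{n},\{\Phi_n\}_{n})$ in $\mathcal{B}(\mathcal{X},\mathcal{Y})$ is an approximately dual operator-valued p-ABS for $(\{A_n\}_{n},\{\Psi_n\}_{n})$ if and only if there exist bounded linear operators $U,V:\mathcal{X}\to\mathcal{X}$ satisfying $\|I_{\mathcal{X}}-U\|<1$ and $\|I_{\mathcal{X}}-V\|<1$ such that $(\{B_nU^{-1}\}_{n},\{V^{-1}\Phi_n\}_{n})$ is a dual for $(\{A_n\}_{n},\{\Psi_n\}_{n})$. The statement holds even if "p-ABS" is replaced by "p-ASF" throughout.
   Context: Banach spaces are over $\mathbb{K}=\mathbb{R}$ or $\mathbb{C}$; $\mathcal{X},\mathcal{Y}$ are Banach spaces, $p\in[1,\infty)$, $\mathcal{B}(\mathcal{X},\mathcal{Y})$ is the space of bounded linear operators. $\ell^p(\mathbb{N})\otimes\mathcal{Y}$ is the completion of the algebraic tensor product in a fixed cross norm ($\|a\otimes y\|=\|a\|\|y\|$) for which, for all $T\in\mathcal{B}(\ell^p(\mathbb{N}))$ and $R\in\mathcal{B}(\mathcal{Y})$, $T\otimes R$ extends to a bounded operator with $\|T\otimes R\|\le\|T\|\|R\|$. With $\{e_n\}_n$ the standard Schauder basis of $\ell^p(\mathbb{N})$, $L_n:\mathcal{Y}\to\ell^p(\mathbb{N})\otimes\mathcal{Y}$ is $L_ny=e_n\otimes y$,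 and $\Gamma_n:\ell^p(\mathbb{N})\otimes\mathcal{Y}\to\mathcal{Y}$ is the bounded linear operator with $\Gamma_n(\{a_m\}_m\otimes y)=a_ny$. Thus $\Gamma_nL_n=I_{\mathcal{Y}}$, $\Gamma_nL_m=0$ for $n\ne m$, and $\sum_{n=1}^\infty L_n\Gamma_nz=z$ for all $z$. For collections $\{A_n\}_{n}$ in $\mathcal{B}(\mathcal{X},\mathcal{Y})$ and $\{\Psi_n\}_{n}$ in $\mathcal{B}(\mathcal{Y},\mathcal{X})$, the pair is an operator-valued p-approximate Schauder frame (operator-valued p-ASF) in $\mathcal{B}(\mathcal{X},\mathcal{Y})$ if: (i) the frame operator $S_{A,\Psi}x=\sum_{n=1}^\infty\Psi_nA_nx$ is a well-defined bounded linear invertible operator on $\mathcal{X}$; (ii) the analysis operator $\theta_A:\mathcal{X}\to\ell^p(\mathbb{N})\otimes\mathcal{Y}$, $\theta_Ax=\sum_{n=1}^\infty L_nA_nx$, is a well-defined bounded linear operator; (iii) the synthesis operator $\theta_\Psi:\ell^p(\mathbb{N})\otimes\mathcal{Y}\to\mathcal{X}$, $\theta_\Psi z=\sum_{n=1}^\infty\Psi_n\Gamma_nz$, is a well-defined bounded linear operator. If invertibility of $S_{A,\Psi}$ is not demanded, the pair is an operator-valued p-approximate Bessel sequence (operator-valued p-ABS). Two operator-valued p-ABSs (resp. p-ASFs) $(\{A_n\}_{n},\{\Psi_n\}_{n})$ and $(\{B_n\}_{n},\{\Phi_n\}_{n})$ are dual p-ABSs (resp. p-ASFs) if $\theta_\Psi\theta_B=\theta_\Phi\theta_A=I_{\mathcal{X}}$;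 they are approximately dual p-ABSs (resp. p-ASFs) if $\|I_{\mathcal{X}}-\theta_\Phi\theta_A\|<1$ and $\|I_{\mathcal{X}}-\theta_\Psi\theta_B\|<1$. *)

theory Defs
  imports "HOL-Analysis.Analysis"
begin

text \<open>
  Scalars range over a type \<open>'k\<close> of class \<^class>\<open>real_normed_field\<close>. By the Gelfand--Mazur theorem
  the only such fields, up to isometric isomorphism, are \<open>real\<close> and \<open>complex\<close>, so this is
  the usual convention that the scalar field is the real or the complex numbers. A Banach space over
  \<open>'k\<close> is a type of class \<^class>\<open>banach\<close> with a compatible scalar multiplication by \<open>'k\<close>.
\<close>

locale banach_over = vector_space scale
  for scale :: "'k::real_normed_field \<Rightarrow> 'x::banach \<Rightarrow> 'x" +
  assumes norm_scale: "norm (scale c x) = norm c * norm x"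
    and scale_of_real: "scale (of_real r) x = r *\<^sub>R x"

lemma banach_over_real: "banach_over (scaleR :: real \<Rightarrow> 'x::banach \<Rightarrow> 'x)"
  by unfold_locales (auto simp: algebra_simps)

lemma banach_over_complex: "banach_over ((*) :: complex \<Rightarrow> complex \<Rightarrow> complex)"
  by unfold_locales (auto simp: algebra_simps norm_mult scaleR_conv_of_real)

text \<open>The space of bounded \<open>'k\<close>-linear operators; its norm is \<^const>\<open>onorm\<close>.\<close>

definition bounded_ops ::
  "('k::real_normed_field \<Rightarrow> 'x::banach \<Rightarrow> 'x) \<Rightarrow> ('k \<Rightarrow> 'y::banach \<Rightarrow> 'y) \<Rightarrow> ('x \<Rightarrow> 'y) set" where
  "bounded_ops sX sY = {f. bounded_linear f \<and> (\<forall>c x. f (sX c x) = sY c (f x))}"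

text \<open>If \<^term>\<open>onorm (\<lambda>x. x - U x) < 1\<close>, the Neumann series shows that \<open>U\<close> is bijective with bounded
  inverse, so that \<^term>\<open>inv U\<close> is then the inverse of \<open>U\<close>.\<close>

definition invertible_op ::
  "('k::real_normed_field \<Rightarrow> 'x::banach \<Rightarrow> 'x) \<Rightarrow> ('x \<Rightarrow> 'x) \<Rightarrow> bool" where
  "invertible_op sX S \<longleftrightarrow> (\<exists>T\<in>bounded_ops sX sX. T \<circ> S = id \<and> S \<circ> T = id)"


section \<open>The sequence spaces\<close>

text \<open>Sequences are indexed from 0 instead of 1.\<close>

definition lp :: "real \<Rightarrow> (nat \<Rightarrow> 'k::real_normed_field) set" where
  "lp p = {a. summable (\<lambda>n. norm (a n) powr p)}"

definition lp_norm :: "real \<Rightarrow> (nat \<Rightarrow> 'k::real_normed_field) \<Rightarrow> real" where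
  "lp_norm p a = (\<Sum>n. norm (a n) powr p) powr (1 / p)"

definition unit_seq :: "nat \<Rightarrow> nat \<Rightarrow> 'k::real_normed_field" where
  "unit_seq n = (\<lambda>m. if m = n then 1 else 0)"

text \<open>Operators on \<^term>\<open>lp p\<close> are total functions on sequences of which only the restriction to
  \<^term>\<open>lp p\<close> matters.\<close>

definition lp_ops ::
  "real \<Rightarrow> ((nat \<Rightarrow> 'k::real_normed_field) \<Rightarrow> nat \<Rightarrow> 'k) set" where
  "lp_ops p = {T.
     (\<forall>a\<in>lp p. T a \<in> lp p) \<and>
     (\<forall>a\<in>lp p. \<forall>b\<in>lp p. T (\<lambda>n. a n + b n) = (\<lambda>n. T a n + T b n)) \<and>
     (\<forall>c. \<forall>a\<in>lp p. T (\<lambda>n. c * a n) = (\<lambda>n. c * T a n)) \<and>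
     (\<exists>C. \<forall>a\<in>lp p. lp_norm p (T a) \<le> C * lp_norm p a)}"

text \<open>As for \<^const>\<open>onorm\<close>, the quotient at the zero sequence is 0.\<close>

definition lp_onorm ::
  "real \<Rightarrow> ((nat \<Rightarrow> 'k::real_normed_field) \<Rightarrow> nat \<Rightarrow> 'k) \<Rightarrow> real" where
  "lp_onorm p T = (SUP a\<in>lp p. lp_norm p (T a) / lp_norm p a)"


section \<open>Tensor products\<close>

text \<open>
  The algebraic tensor product is the span of the elementary tensors \<open>a \<otimes> y\<close>, where
  \<open>a \<otimes> y\<close> is the evaluation functional \<open>B \<mapsto> B a y\<close> on the space of all (algebraic) bilinear forms.
  Its vector space structure is pointwise. Functionals are taken to be 0 off the bilinear forms, so
  that equality of functions is equality of tensors.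
\<close>

type_synonym ('k, 'y) tensor = "((nat \<Rightarrow> 'k) \<Rightarrow> 'y \<Rightarrow> 'k) \<Rightarrow> 'k"

definition bilinear_forms ::
  "real \<Rightarrow> ('k::real_normed_field \<Rightarrow> 'y::banach \<Rightarrow> 'y) \<Rightarrow> ((nat \<Rightarrow> 'k) \<Rightarrow> 'y \<Rightarrow> 'k) set" where
  "bilinear_forms p sY = {B.
     (\<forall>y. \<forall>a\<in>lp p. \<forall>b\<in>lp p. B (\<lambda>n. a n + b n) y = B a y + B b y) \<and>
     (\<forall>c y. \<forall>a\<in>lp p. B (\<lambda>n. c * a n) y = c * B a y) \<and>
     (\<forall>a\<in>lp p. Vector_Spaces.linear sY (*) (B a))}"

definition elem_tensor ::
  "real \<Rightarrow> ('k::real_normed_field \<Rightarrow> 'y::banach \<Rightarrow> 'y) \<Rightarrow> (nat \<Rightarrow> 'k) \<Rightarrow> 'y \<Rightarrow> ('k, 'y) tensor" where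
  "elem_tensor p sY a y = (\<lambda>B. if B \<in> bilinear_forms p sY then B a y else 0)"

definition alg_tensor ::
  "real \<Rightarrow> ('k::real_normed_field \<Rightarrow> 'y::banach \<Rightarrow> 'y) \<Rightarrow> ('k, 'y) tensor set" where
  "alg_tensor p sY =
     {\<lambda>B. \<Sum>(a, y)\<leftarrow>ts. elem_tensor p sY a y B | ts. \<forall>(a, y)\<in>set ts. a \<in> lp p}"

locale cross_norm =
  fixes p :: real
    and sY :: "'k::real_normed_field \<Rightarrow> 'y::banach \<Rightarrow> 'y"
    and N :: "('k, 'y) tensor \<Rightarrow> real"
  assumes nonneg: "t \<in> alg_tensor p sY \<Longrightarrow> 0 \<le> N t"
    and definite: "t \<in> alg_tensor p sY \<Longrightarrow> N t = 0 \<longleftrightarrow> t = (\<lambda>B. 0)"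
    and triangle: "t \<in> alg_tensor p sY \<Longrightarrow> u \<in> alg_tensor p sY \<Longrightarrow> N (\<lambda>B. t B + u B) \<le> N t + N u"
    and homogeneous: "t \<in> alg_tensor p sY \<Longrightarrow> N (\<lambda>B. c * t B) = norm c * N t"
    and cross: "a \<in> lp p \<Longrightarrow> N (elem_tensor p sY a y) = lp_norm p a * norm y"

text \<open>
  The type \<open>'z\<close> with embedding \<open>j\<close> is the completion of the algebraic tensor product in a cross norm
  \<open>N\<close> for which all operators \<open>T \<otimes> R\<close> extend to the completion with norm at most
  \<open>\<parallel>T\<parallel> \<parallel>R\<parallel>\<close>.
\<close>

locale lp_tensor_completion =
  Y: banach_over sY + Z: banach_over sZ + cross_norm p sY N
  for p :: real
    and sY :: "'k::real_normed_field \<Rightarrow> 'y::banach \<Rightarrow> 'y"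
    and N :: "('k, 'y) tensor \<Rightarrow> real"
    and sZ :: "'k \<Rightarrow> 'z::banach \<Rightarrow> 'z"
    and j :: "('k, 'y) tensor \<Rightarrow> 'z" +
  assumes p_ge_1: "1 \<le> p"
    and j_add: "t \<in> alg_tensor p sY \<Longrightarrow> u \<in> alg_tensor p sY \<Longrightarrow> j (\<lambda>B. t B + u B) = j t + j u"
    and j_scale: "t \<in> alg_tensor p sY \<Longrightarrow> j (\<lambda>B. c * t B) = sZ c (j t)"
    and j_isometric: "t \<in> alg_tensor p sY \<Longrightarrow> norm (j t) = N t"
    and j_dense: "closure (j ` alg_tensor p sY) = UNIV"
    and tensor_op: "T \<in> lp_ops p \<Longrightarrow> R \<in> bounded_ops sY sY \<Longrightarrow>
      \<exists>W\<in>bounded_ops sZ sZ.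
        (\<forall>a\<in>lp p. \<forall>y. W (j (elem_tensor p sY a y)) = j (elem_tensor p sY (T a) (R y))) \<and>
        onorm W \<le> lp_onorm p T * onorm R"

definition coord_embed ::
  "real \<Rightarrow> ('k::real_normed_field \<Rightarrow> 'y::banach \<Rightarrow> 'y) \<Rightarrow> (('k, 'y) tensor \<Rightarrow> 'z::banach) \<Rightarrow>
   nat \<Rightarrow> 'y \<Rightarrow> 'z" where
  "coord_embed p sY j n y = j (elem_tensor p sY (unit_seq n) y)"

definition coord_proj ::
  "real \<Rightarrow> ('k::real_normed_field \<Rightarrow> 'y::banach \<Rightarrow> 'y) \<Rightarrow> ('k \<Rightarrow> 'z::banach \<Rightarrow> 'z) \<Rightarrow>
   (('k, 'y) tensor \<Rightarrow> 'z) \<Rightarrow> nat \<Rightarrow> 'z \<Rightarrow> 'y" where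
  "coord_proj p sY sZ j n = (THE G. G \<in> bounded_ops sZ sY \<and>
     (\<forall>a\<in>lp p. \<forall>y. G (j (elem_tensor p sY a y)) = sY (a n) y))"

context lp_tensor_completion
begin

lemma elem_in: "a \<in> lp p \<Longrightarrow> elem_tensor p sY a y \<in> alg_tensor p sY"
  unfolding alg_tensor_def by (rule CollectI, rule exI[of _ "[(a, y)]"]) auto

lemma zero_in: "(\<lambda>B. 0) \<in> alg_tensor p sY"
  unfolding alg_tensor_def by (rule CollectI, rule exI[of _ "[]"]) auto

lemma j_zero: "j (\<lambda>B. 0) = 0"
  using j_scale[OF zero_in, of 0] by simp

lemma alg_tensor_induct:
  assumes "t \<in> alg_tensor p sY" "P 0"
    and "\<And>z w. P z \<Longrightarrow> P w \<Longrightarrow> P (z + w)"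
    and "\<And>a y. a \<in> lp p \<Longrightarrow> P (j (elem_tensor p sY a y))"
  shows "P (j t)"
proof -
  obtain ts where t: "t = (\<lambda>B. \<Sum>(a, y)\<leftarrow>ts. elem_tensor p sY a y B)"
    and ts: "\<forall>(a, y)\<in>set ts. a \<in> lp p"
    using assms(1) unfolding alg_tensor_def by blast
  from ts have "P (j (\<lambda>B. \<Sum>(a, y)\<leftarrow>ts. elem_tensor p sY a y B))"
  proof (induction ts)
    case Nil
    then show ?case using assms(2) by (simp add: j_zero)
  next
    case (Cons q ts)
    obtain a y where q: "q = (a, y)" by (cases q)
    have "(\<lambda>B. \<Sum>(a, y)\<leftarrow>ts. elem_tensor p sY a y B) \<in> alg_tensor p sY"
      unfolding alg_tensor_def using Cons.prems by auto
    moreover have "a \<in> lp p" using Cons.prems q by auto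
    ultimately show ?case
      using Cons by (simp add: q j_add elem_in assms(3,4))
  qed
  then show ?thesis by (simp add: t)
qed

lemma unit_seq_sums: "(\<lambda>m. norm (c * unit_seq n m :: 'k) powr p) sums (norm c powr p)"
proof -
  have "(\<lambda>m. norm (c * unit_seq n m :: 'k) powr p) = (\<lambda>m. if m = n then norm c powr p else 0)"
    using p_ge_1 by (auto simp: unit_seq_def)
  then show ?thesis using sums_single[of n "\<lambda>_. norm c powr p"] by simp
qed

lemma unit_seq_lp: "(\<lambda>m. c * unit_seq n m :: 'k) \<in> lp p" "(unit_seq n :: nat \<Rightarrow> 'k) \<in> lp p"
  using unit_seq_sums[of c n] unit_seq_sums[of 1 n] by (auto simp: lp_def sums_iff)

lemma unit_seq_norm: "lp_norm p (\<lambda>m. c * unit_seq n m :: 'k) = norm c"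
  using unit_seq_sums[of c n] p_ge_1 by (simp add: lp_norm_def sums_iff powr_powr)

lemma elem_scale: "a \<in> lp p \<Longrightarrow> elem_tensor p sY (\<lambda>n. c * a n) y = elem_tensor p sY a (sY c y)"
  and elem_scale': "a \<in> lp p \<Longrightarrow> elem_tensor p sY a (sY c y) = (\<lambda>B. c * elem_tensor p sY a y B)"
  and elem_add: "a \<in> lp p \<Longrightarrow> elem_tensor p sY a (y + y') =
    (\<lambda>B. elem_tensor p sY a y B + elem_tensor p sY a y' B)"
  by (auto simp: elem_tensor_def bilinear_forms_def fun_eq_iff module_hom.scale module_hom.add
      linear_iff_module_hom)

text \<open>The embeddings are isometric, and the defining properties of \<^const>\<open>coord_proj\<close> have a unique
  solution.\<close>

lemma coord_embed_add: "coord_embed p sY j n (y + y') = coord_embed p sY j n y + coord_embed p sY j n y'"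
  by (simp add: coord_embed_def elem_add unit_seq_lp j_add elem_in)

lemma coord_embed_scale: "coord_embed p sY j n (sY c y) = sZ c (coord_embed p sY j n y)"
  by (simp add: coord_embed_def elem_scale' unit_seq_lp j_scale elem_in)

lemma coord_embed_norm: "norm (coord_embed p sY j n y) = norm y"
  using unit_seq_norm[of 1 n]
  by (simp add: coord_embed_def j_isometric elem_in unit_seq_lp cross)

lemma coord_embed_bounded_ops: "coord_embed p sY j n \<in> bounded_ops sY sZ"
  unfolding bounded_ops_def
  by (auto simp: coord_embed_add coord_embed_scale coord_embed_norm
      simp flip: Y.scale_of_real Z.scale_of_real intro!: bounded_linear_intro[of _ 1])

lemma coord_lp_ops: "(\<lambda>a m. a n * unit_seq n m :: 'k) \<in> lp_ops p"
proof -
  have "lp_norm p (\<lambda>m. a n * unit_seq n m) \<le> lp_norm p a" if "a \<in> lp p" for a :: "nat \<Rightarrow> 'k"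
  proof -
    have s: "summable (\<lambda>m. norm (a m) powr p)" using that by (simp add: lp_def)
    have "norm (a n) powr p \<le> (\<Sum>m. norm (a m) powr p)"
      using sum_le_suminf[OF s, of "{n}"] by simp
    then have "(norm (a n) powr p) powr (1/p) \<le> lp_norm p a"
      unfolding lp_norm_def using p_ge_1 by (intro powr_mono2) auto
    then show ?thesis using p_ge_1 by (simp add: unit_seq_norm powr_powr)
  qed
  then have "\<exists>C. \<forall>a\<in>lp p. lp_norm p (\<lambda>m. a n * unit_seq n m :: 'k) \<le> C * lp_norm p a"
    by (intro exI[of _ 1]) auto
  then show ?thesis by (auto simp: lp_ops_def unit_seq_lp algebra_simps)
qed

lemma coord_proj_ex1:
  "\<exists>!G. G \<in> bounded_ops sZ sY \<and> (\<forall>a\<in>lp p. \<forall>y. G (j (elem_tensor p sY a y)) = sY (a n) y)"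
proof (rule ex_ex1I)
  let ?L = "coord_embed p sY j n"
  have Lbl: "bounded_linear ?L" using coord_embed_bounded_ops by (simp add: bounded_ops_def)
  have "(\<lambda>y. y) \<in> bounded_ops sY sY" by (simp add: bounded_ops_def)
  then obtain W where W: "W \<in> bounded_ops sZ sZ"
    and WL: "\<And>a y. a \<in> lp p \<Longrightarrow>
      W (j (elem_tensor p sY a y)) = j (elem_tensor p sY (\<lambda>m. a n * unit_seq n m) y)"
    using tensor_op[OF coord_lp_ops[of n]] by blast
  have WL': "W (j (elem_tensor p sY a y)) = ?L (sY (a n) y)" if "a \<in> lp p" for a y
    using that by (simp add: WL elem_scale unit_seq_lp coord_embed_def)
  have Wbl: "bounded_linear W" and Ws: "\<And>c z. W (sZ c z) = sZ c (W z)"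
    using W by (auto simp: bounded_ops_def)
  have inj: "inj ?L"
  proof (rule injI)
    fix y y' assume "?L y = ?L y'"
    then have "norm (?L (y - y')) = 0" by (simp add: linear_diff[OF bounded_linear.linear[OF Lbl]])
    then show "y = y'" by (simp add: coord_embed_norm)
  qed
  have "complete (range ?L)"
    by (rule complete_isometric_image[of 1 UNIV])
      (auto simp: Lbl coord_embed_norm complete_UNIV)
  then have cl: "closed (range ?L)" by (rule complete_imp_closed)
  have "W (j t) \<in> range ?L" if "t \<in> alg_tensor p sY" for t
    using that
  proof (rule alg_tensor_induct)
    show "W 0 \<in> range ?L"
      by (metis Lbl Wbl linear_simps(3) rangeI)
    show "W (z + w) \<in> range ?L" if "W z \<in> range ?L" "W w \<in> range ?L" for z w
      using that by (auto simp: linear_simps(1)[OF Wbl] coord_embed_add[symmetric])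
    show "W (j (elem_tensor p sY a y)) \<in> range ?L" if "a \<in> lp p" for a y
      using that by (simp add: WL')
  qed
  then have "W ` closure (j ` alg_tensor p sY) \<subseteq> range ?L"
    by (intro image_closure_subset cl continuous_on_subset[OF linear_continuous_on[OF Wbl]]) auto
  then have WR: "?L (inv ?L (W z)) = W z" for z
    using j_dense f_inv_into_f[of "W z" ?L UNIV] by auto
  define G where "G = (\<lambda>z. inv ?L (W z))"
  have LG: "?L (G z) = W z" for z by (simp add: G_def WR)
  obtain K where K: "\<And>z. norm (W z) \<le> norm z * K"
    using bounded_linear.bounded[OF Wbl] by blast
  have Gs: "G (sZ c z) = sY c (G z)" for c z
    by (rule injD[OF inj]) (simp add: LG coord_embed_scale Ws)
  have "bounded_linear G"
  proof (rule bounded_linear_intro)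
    show "G (z + w) = G z + G w" for z w
      by (rule injD[OF inj]) (simp add: LG coord_embed_add linear_simps(1)[OF Wbl])
    show "G (r *\<^sub>R z) = r *\<^sub>R G z" for r z
      using Gs[of "of_real r" z] by (simp add: Y.scale_of_real Z.scale_of_real)
    show "norm (G z) \<le> norm z * K" for z
      using K[of z] coord_embed_norm[of n "G z"] by (simp add: LG)
  qed
  moreover have "G (j (elem_tensor p sY a y)) = sY (a n) y" if "a \<in> lp p" for a y
    by (rule injD[OF inj]) (simp add: LG WL' that)
  ultimately show "\<exists>G. G \<in> bounded_ops sZ sY \<and> (\<forall>a\<in>lp p. \<forall>y. G (j (elem_tensor p sY a y)) = sY (a n) y)"
    using Gs by (intro exI[of _ G]) (auto simp: bounded_ops_def)
next
  fix G H
  assume G: "G \<in> bounded_ops sZ sY \<and> (\<forall>a\<in>lp p. \<forall>y. G (j (elem_tensor p sY a y)) = sY (a n) y)"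
    and H: "H \<in> bounded_ops sZ sY \<and> (\<forall>a\<in>lp p. \<forall>y. H (j (elem_tensor p sY a y)) = sY (a n) y)"
  have bl: "bounded_linear (\<lambda>z. G z - H z)"
    using G H by (auto simp: bounded_ops_def intro: bounded_linear_sub)
  have "G (j t) - H (j t) = 0" if "t \<in> alg_tensor p sY" for t
    using that
  proof (rule alg_tensor_induct)
    show "G 0 - H 0 = 0" using linear_simps(3)[OF bl] .
    show "G (z + w) - H (z + w) = 0" if "G z - H z = 0" "G w - H w = 0" for z w
      using that linear_simps(1)[OF bl, of z w] by simp
  qed (use G H in simp)
  then have "(\<lambda>z. G z - H z) ` closure (j ` alg_tensor p sY) \<subseteq> {0}"
    by (intro image_closure_subset continuous_on_subset[OF linear_continuous_on[OF bl]]) auto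
  then have "G z - H z = 0" for z unfolding j_dense by blast
  then show "G = H" by (simp add: fun_eq_iff)
qed

lemma coord_proj:
  shows coord_proj_bounded_ops: "coord_proj p sY sZ j n \<in> bounded_ops sZ sY"
    and coord_proj_elem: "a \<in> lp p \<Longrightarrow> coord_proj p sY sZ j n (j (elem_tensor p sY a y)) = sY (a n) y"
  using theI'[OF coord_proj_ex1[of n]] by (auto simp: coord_proj_def)

lemma coord_proj_embed:
  "coord_proj p sY sZ j m (coord_embed p sY j n y) = (if m = n then y else 0)"
  by (simp add: coord_embed_def coord_proj_elem unit_seq_lp) (simp add: unit_seq_def)

end


section \<open>Operator-valued approximate Bessel sequences and Schauder frames\<close>

definition frame_op :: "(nat \<Rightarrow> 'x::banach \<Rightarrow> 'y::banach) \<Rightarrow> (nat \<Rightarrow> 'y \<Rightarrow> 'x) \<Rightarrow> 'x \<Rightarrow> 'x" where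
  "frame_op A \<Psi> x = (\<Sum>n. \<Psi> n (A n x))"

definition analysis_op ::
  "real \<Rightarrow> ('k::real_normed_field \<Rightarrow> 'y::banach \<Rightarrow> 'y) \<Rightarrow> (('k, 'y) tensor \<Rightarrow> 'z::banach) \<Rightarrow>
   (nat \<Rightarrow> 'x::banach \<Rightarrow> 'y) \<Rightarrow> 'x \<Rightarrow> 'z" where
  "analysis_op p sY j A x = (\<Sum>n. coord_embed p sY j n (A n x))"

definition synthesis_op ::
  "real \<Rightarrow> ('k::real_normed_field \<Rightarrow> 'y::banach \<Rightarrow> 'y) \<Rightarrow> ('k \<Rightarrow> 'z::banach \<Rightarrow> 'z) \<Rightarrow>
   (('k, 'y) tensor \<Rightarrow> 'z) \<Rightarrow> (nat \<Rightarrow> 'y \<Rightarrow> 'x::banach) \<Rightarrow> 'z \<Rightarrow> 'x" where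
  "synthesis_op p sY sZ j \<Psi> z = (\<Sum>n. \<Psi> n (coord_proj p sY sZ j n z))"

text \<open>In each clause ``well-defined'' is norm convergence of the series at every point.\<close>

definition p_ABS ::
  "real \<Rightarrow> ('k::real_normed_field \<Rightarrow> 'x::banach \<Rightarrow> 'x) \<Rightarrow> ('k \<Rightarrow> 'y::banach \<Rightarrow> 'y) \<Rightarrow>
   ('k \<Rightarrow> 'z::banach \<Rightarrow> 'z) \<Rightarrow> (('k, 'y) tensor \<Rightarrow> 'z) \<Rightarrow>
   (nat \<Rightarrow> 'x \<Rightarrow> 'y) \<Rightarrow> (nat \<Rightarrow> 'y \<Rightarrow> 'x) \<Rightarrow> bool" where
  "p_ABS p sX sY sZ j A \<Psi> \<longleftrightarrow>
     (\<forall>n. A n \<in> bounded_ops sX sY) \<and> (\<forall>n. \<Psi> n \<in> bounded_ops sY sX) \<and>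
     (\<forall>x. summable (\<lambda>n. \<Psi> n (A n x))) \<and>
     frame_op A \<Psi> \<in> bounded_ops sX sX \<and>
     (\<forall>x. summable (\<lambda>n. coord_embed p sY j n (A n x))) \<and>
     analysis_op p sY j A \<in> bounded_ops sX sZ \<and>
     (\<forall>z. summable (\<lambda>n. \<Psi> n (coord_proj p sY sZ j n z))) \<and>
     synthesis_op p sY sZ j \<Psi> \<in> bounded_ops sZ sX"

definition p_ASF ::
  "real \<Rightarrow> ('k::real_normed_field \<Rightarrow> 'x::banach \<Rightarrow> 'x) \<Rightarrow> ('k \<Rightarrow> 'y::banach \<Rightarrow> 'y) \<Rightarrow>
   ('k \<Rightarrow> 'z::banach \<Rightarrow> 'z) \<Rightarrow> (('k, 'y) tensor \<Rightarrow> 'z) \<Rightarrow>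
   (nat \<Rightarrow> 'x \<Rightarrow> 'y) \<Rightarrow> (nat \<Rightarrow> 'y \<Rightarrow> 'x) \<Rightarrow> bool" where
  "p_ASF p sX sY sZ j A \<Psi> \<longleftrightarrow> p_ABS p sX sY sZ j A \<Psi> \<and> invertible_op sX (frame_op A \<Psi>)"

definition dual_p_ABS ::
  "real \<Rightarrow> ('k::real_normed_field \<Rightarrow> 'x::banach \<Rightarrow> 'x) \<Rightarrow> ('k \<Rightarrow> 'y::banach \<Rightarrow> 'y) \<Rightarrow>
   ('k \<Rightarrow> 'z::banach \<Rightarrow> 'z) \<Rightarrow> (('k, 'y) tensor \<Rightarrow> 'z) \<Rightarrow>
   (nat \<Rightarrow> 'x \<Rightarrow> 'y) \<Rightarrow> (nat \<Rightarrow> 'y \<Rightarrow> 'x) \<Rightarrow> (nat \<Rightarrow> 'x \<Rightarrow> 'y) \<Rightarrow> (nat \<Rightarrow> 'y \<Rightarrow> 'x) \<Rightarrow> bool" where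
  "dual_p_ABS p sX sY sZ j A \<Psi> B \<Phi> \<longleftrightarrow>
     p_ABS p sX sY sZ j A \<Psi> \<and> p_ABS p sX sY sZ j B \<Phi> \<and>
     synthesis_op p sY sZ j \<Psi> \<circ> analysis_op p sY j B = id \<and>
     synthesis_op p sY sZ j \<Phi> \<circ> analysis_op p sY j A = id"

definition dual_p_ASF ::
  "real \<Rightarrow> ('k::real_normed_field \<Rightarrow> 'x::banach \<Rightarrow> 'x) \<Rightarrow> ('k \<Rightarrow> 'y::banach \<Rightarrow> 'y) \<Rightarrow>
   ('k \<Rightarrow> 'z::banach \<Rightarrow> 'z) \<Rightarrow> (('k, 'y) tensor \<Rightarrow> 'z) \<Rightarrow>
   (nat \<Rightarrow> 'x \<Rightarrow> 'y) \<Rightarrow> (nat \<Rightarrow> 'y \<Rightarrow> 'x) \<Rightarrow> (nat \<Rightarrow> 'x \<Rightarrow> 'y) \<Rightarrow> (nat \<Rightarrow> 'y \<Rightarrow> 'x) \<Rightarrow> bool" where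
  "dual_p_ASF p sX sY sZ j A \<Psi> B \<Phi> \<longleftrightarrow>
     p_ASF p sX sY sZ j A \<Psi> \<and> p_ASF p sX sY sZ j B \<Phi> \<and>
     synthesis_op p sY sZ j \<Psi> \<circ> analysis_op p sY j B = id \<and>
     synthesis_op p sY sZ j \<Phi> \<circ> analysis_op p sY j A = id"

definition approx_dual_p_ABS ::
  "real \<Rightarrow> ('k::real_normed_field \<Rightarrow> 'x::banach \<Rightarrow> 'x) \<Rightarrow> ('k \<Rightarrow> 'y::banach \<Rightarrow> 'y) \<Rightarrow>
   ('k \<Rightarrow> 'z::banach \<Rightarrow> 'z) \<Rightarrow> (('k, 'y) tensor \<Rightarrow> 'z) \<Rightarrow>
   (nat \<Rightarrow> 'x \<Rightarrow> 'y) \<Rightarrow> (nat \<Rightarrow> 'y \<Rightarrow> 'x) \<Rightarrow> (nat \<Rightarrow> 'x \<Rightarrow> 'y) \<Rightarrow> (nat \<Rightarrow> 'y \<Rightarrow> 'x) \<Rightarrow> bool" where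
  "approx_dual_p_ABS p sX sY sZ j A \<Psi> B \<Phi> \<longleftrightarrow>
     p_ABS p sX sY sZ j A \<Psi> \<and> p_ABS p sX sY sZ j B \<Phi> \<and>
     onorm (\<lambda>x. x - synthesis_op p sY sZ j \<Phi> (analysis_op p sY j A x)) < 1 \<and>
     onorm (\<lambda>x. x - synthesis_op p sY sZ j \<Psi> (analysis_op p sY j B x)) < 1"

definition approx_dual_p_ASF ::
  "real \<Rightarrow> ('k::real_normed_field \<Rightarrow> 'x::banach \<Rightarrow> 'x) \<Rightarrow> ('k \<Rightarrow> 'y::banach \<Rightarrow> 'y) \<Rightarrow>
   ('k \<Rightarrow> 'z::banach \<Rightarrow> 'z) \<Rightarrow> (('k, 'y) tensor \<Rightarrow> 'z) \<Rightarrow>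
   (nat \<Rightarrow> 'x \<Rightarrow> 'y) \<Rightarrow> (nat \<Rightarrow> 'y \<Rightarrow> 'x) \<Rightarrow> (nat \<Rightarrow> 'x \<Rightarrow> 'y) \<Rightarrow> (nat \<Rightarrow> 'y \<Rightarrow> 'x) \<Rightarrow> bool" where
  "approx_dual_p_ASF p sX sY sZ j A \<Psi> B \<Phi> \<longleftrightarrow>
     p_ASF p sX sY sZ j A \<Psi> \<and> p_ASF p sX sY sZ j B \<Phi> \<and>
     onorm (\<lambda>x. x - synthesis_op p sY sZ j \<Phi> (analysis_op p sY j A x)) < 1 \<and>
     onorm (\<lambda>x. x - synthesis_op p sY sZ j \<Psi> (analysis_op p sY j B x)) < 1"

end

theory Submission
  imports Defs
begin

text \<open>
  Precomposing the \<open>B n\<close> with \<open>U\<inverse>\<close> turns the analysis operator \<open>\<theta>\<^sub>B\<close> into \<open>\<theta>\<^sub>B U\<inverse>\<close>, and postcomposing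
  the \<open>\<Phi> n\<close> with the bounded operator \<open>V\<inverse>\<close> turns the synthesis operator \<open>\<theta>\<^sub>\<Phi>\<close> into \<open>V\<inverse> \<theta>\<^sub>\<Phi>\<close>. So the two
  duality equations for the modified pair read \<open>\<theta>\<^sub>\<Psi> \<theta>\<^sub>B U\<inverse> = I\<close> and \<open>V\<inverse> \<theta>\<^sub>\<Phi> \<theta>\<^sub>A = I\<close>, which says exactly
  that \<open>U = \<theta>\<^sub>\<Psi> \<theta>\<^sub>B\<close> and \<open>V = \<theta>\<^sub>\<Phi> \<theta>\<^sub>A\<close> (\<open>dual_twist_iff\<close>). The operators \<open>U\<close> and \<open>V\<close> are thereby
  forced, and the norm conditions on them are the two inequalities that define approximate duality.

  What remains is that the modified pair is again a Bessel sequence or a frame. An operator at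
  distance less than 1 from the identity is invertible (\<open>invertible_op_near_id\<close>), and the frame
  operator of the modified pair is \<open>V\<inverse> S U\<inverse>\<close>, which inherits boundedness and invertibility
  from the frame operator \<open>S\<close> of the original pair (\<open>p_ABS_twist\<close>, \<open>p_ASF_twist\<close>).
\<close>

lemma bounded_ops_comp:
  assumes "g \<in> bounded_ops sY sZ" "f \<in> bounded_ops sX sY"
  shows "g \<circ> f \<in> bounded_ops sX sZ"
  using assms by (auto simp: bounded_ops_def o_def intro: bounded_linear_compose)

lemma invertible_op_inv:
  assumes "invertible_op s U"
  shows "inv U \<in> bounded_ops s s" "inv U \<circ> U = id" "U \<circ> inv U = id"
proof -
  obtain T where T: "T \<in> bounded_ops s s" "T \<circ> U = id" "U \<circ> T = id"
    using assms by (auto simp: invertible_op_def)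
  then have "inv U = T" by (metis inv_unique_comp)
  then show "inv U \<in> bounded_ops s s" "inv U \<circ> U = id" "U \<circ> inv U = id"
    using T by simp_all
qed

text \<open>
  With \<open>q = \<parallel>I - U\<parallel> < 1\<close>, a solution of \<open>U x = y\<close> is a fixed point of the \<open>q\<close>-contraction
  \<open>x \<mapsto> y + (x - U x)\<close>, so \<open>U\<close> is bijective. The lower bound \<open>(1 - q) \<parallel>x\<parallel> \<le> \<parallel>U x\<parallel>\<close> bounds its inverse.
\<close>

lemma invertible_op_near_id:
  assumes U: "U \<in> bounded_ops s s" and less: "onorm (\<lambda>x. x - U x) < 1"
  shows "invertible_op s U"
proof -
  define q where "q = onorm (\<lambda>x. x - U x)"
  have bl: "bounded_linear U" and Us: "\<And>c x. U (s c x) = s c (U x)"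
    using U by (auto simp: bounded_ops_def)
  have blD: "bounded_linear (\<lambda>x. x - U x)"
    using bl by (intro bounded_linear_sub bounded_linear_ident)
  have q: "0 \<le> q" "q < 1" using onorm_pos_le[OF blD] less by (auto simp: q_def)
  have contr: "norm (x - U x) \<le> q * norm x" for x
    using onorm[OF blD, of x] by (simp add: q_def)
  have "\<exists>!x. y + (x - U x) = x" for y
  proof (rule banach_fix_type[OF q], intro allI)
    fix x x'
    have "dist (y + (x - U x)) (y + (x' - U x')) = norm ((x - x') - U (x - x'))"
      by (simp add: dist_norm linear_diff[OF bounded_linear.linear[OF bl]] algebra_simps)
    also have "\<dots> \<le> q * dist x x'" using contr[of "x - x'"] by (simp add: dist_norm)
    finally show "dist (y + (x - U x)) (y + (x' - U x')) \<le> q * dist x x'" .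
  qed
  moreover have "y + (x - U x) = x \<longleftrightarrow> U x = y" for x y
    by (metis add.commute add_diff_cancel_left' add_diff_eq diff_add_cancel)
  ultimately have "\<exists>!x. U x = y" for y by simp
  then have bij: "bij U" by (auto simp: bij_iff)
  then have inj: "inj U" and U_inv: "\<And>y. U (inv U y) = y"
    by (auto simp: bij_def surj_f_inv_f)
  have inv_scale: "inv U (s c y) = s c (inv U y)" for c y
    by (rule injD[OF inj]) (simp add: U_inv Us)
  have "bounded_linear (inv U)"
  proof (rule bounded_linear_intro)
    show "inv U (y + z) = inv U y + inv U z" for y z
      by (rule injD[OF inj]) (simp add: U_inv linear_simps(1)[OF bl])
    show "inv U (r *\<^sub>R y) = r *\<^sub>R inv U y" for r y
      by (rule injD[OF inj]) (simp add: U_inv linear_simps(5)[OF bl])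
    show "norm (inv U y) \<le> norm y * (1 / (1 - q))" for y
    proof -
      have "norm (inv U y) \<le> norm (inv U y - y) + norm y"
        using norm_triangle_sub[of "inv U y" y] by simp
      also have "\<dots> \<le> q * norm (inv U y) + norm y"
        using contr[of "inv U y"] by (simp add: U_inv)
      finally show ?thesis using q by (simp add: field_simps)
    qed
  qed
  then have "inv U \<in> bounded_ops s s" by (simp add: bounded_ops_def inv_scale)
  moreover have "inv U \<circ> U = id" "U \<circ> inv U = id"
    using inj by (simp_all add: fun_eq_iff U_inv)
  ultimately show ?thesis unfolding invertible_op_def by blast
qed

lemma analysis_op_comp:
  "analysis_op p sY j (\<lambda>n. B n \<circ> R) = analysis_op p sY j B \<circ> R"
  by (simp add: analysis_op_def fun_eq_iff)

lemma synthesis_op_comp: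
  assumes "bounded_linear Q" "\<And>z. summable (\<lambda>n. \<Phi> n (coord_proj p sY sZ j n z))"
  shows "synthesis_op p sY sZ j (\<lambda>n. Q \<circ> \<Phi> n) = Q \<circ> synthesis_op p sY sZ j \<Phi>"
  by (simp add: synthesis_op_def fun_eq_iff bounded_linear.suminf[OF assms])

lemma frame_op_comp:
  assumes "bounded_linear Q" "\<And>x. summable (\<lambda>n. \<Phi> n (B n x))"
  shows "frame_op (\<lambda>n. B n \<circ> R) (\<lambda>n. Q \<circ> \<Phi> n) = Q \<circ> frame_op B \<Phi> \<circ> R"
  by (simp add: frame_op_def fun_eq_iff bounded_linear.suminf[OF assms])

lemma p_ABS_twist:
  assumes "p_ABS p sX sY sZ j B \<Phi>" "R \<in> bounded_ops sX sX" "Q \<in> bounded_ops sX sX"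
  shows "p_ABS p sX sY sZ j (\<lambda>n. B n \<circ> R) (\<lambda>n. Q \<circ> \<Phi> n)"
proof -
  have Q: "bounded_linear Q" using assms(3) by (simp add: bounded_ops_def)
  show ?thesis
    using assms unfolding p_ABS_def
    by (simp add: analysis_op_comp synthesis_op_comp[OF Q] frame_op_comp[OF Q]
        bounded_linear.summable[OF Q]) (blast intro: bounded_ops_comp)
qed

lemma p_ASF_twist:
  assumes BF: "p_ASF p sX sY sZ j B \<Phi>"
    and U: "U \<in> bounded_ops sX sX" "invertible_op sX U"
    and V: "V \<in> bounded_ops sX sX" "invertible_op sX V"
  shows "p_ASF p sX sY sZ j (\<lambda>n. B n \<circ> inv U) (\<lambda>n. inv V \<circ> \<Phi> n)"
proof -
  note iU = invertible_op_inv[OF U(2)] and iV = invertible_op_inv[OF V(2)]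
  have ABS: "p_ABS p sX sY sZ j B \<Phi>" using BF by (simp add: p_ASF_def)
  let ?S = "frame_op B \<Phi>"
  obtain T where T: "T \<in> bounded_ops sX sX" "T \<circ> ?S = id" "?S \<circ> T = id"
    using BF by (auto simp: p_ASF_def invertible_op_def)
  have "frame_op (\<lambda>n. B n \<circ> inv U) (\<lambda>n. inv V \<circ> \<Phi> n) = inv V \<circ> ?S \<circ> inv U"
    using ABS iV(1) by (intro frame_op_comp) (auto simp: p_ABS_def bounded_ops_def)
  moreover have "invertible_op sX (inv V \<circ> ?S \<circ> inv U)"
    unfolding invertible_op_def
  proof (intro bexI[of _ "U \<circ> T \<circ> V"] conjI)
    show "U \<circ> T \<circ> V \<in> bounded_ops sX sX" using U(1) V(1) T(1) by (intro bounded_ops_comp)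
    show "U \<circ> T \<circ> V \<circ> (inv V \<circ> ?S \<circ> inv U) = id"
      using iU(3) iV(3) T(2) by (simp add: fun_eq_iff)
    show "inv V \<circ> ?S \<circ> inv U \<circ> (U \<circ> T \<circ> V) = id"
      using iU(2) iV(2) T(3) by (simp add: fun_eq_iff)
  qed
  ultimately show ?thesis
    using p_ABS_twist[OF ABS iU(1) iV(1)] by (simp add: p_ASF_def)
qed

text \<open>
  Cancelling the inverses in the duality equations determines \<open>U\<close> and \<open>V\<close>. This carries both
  directions of the characterization, for Bessel sequences and for frames.
\<close>

lemma dual_twist_iff:
  assumes BF: "p_ABS p sX sY sZ j B \<Phi>"
    and U: "invertible_op sX U" and V: "invertible_op sX V"
  shows "synthesis_op p sY sZ j \<Psi> \<circ> analysis_op p sY j (\<lambda>n. B n \<circ> inv U) = id \<and>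
      synthesis_op p sY sZ j (\<lambda>n. inv V \<circ> \<Phi> n) \<circ> analysis_op p sY j A = id \<longleftrightarrow>
    U = synthesis_op p sY sZ j \<Psi> \<circ> analysis_op p sY j B \<and>
      V = synthesis_op p sY sZ j \<Phi> \<circ> analysis_op p sY j A"
proof -
  note iU = invertible_op_inv[OF U] and iV = invertible_op_inv[OF V]
  have syn: "synthesis_op p sY sZ j (\<lambda>n. inv V \<circ> \<Phi> n) = inv V \<circ> synthesis_op p sY sZ j \<Phi>"
    using BF iV(1) by (intro synthesis_op_comp) (auto simp: p_ABS_def bounded_ops_def)
  have cancel_U: "W \<circ> inv U = id \<longleftrightarrow> U = W" for W
    using iU by (metis comp_assoc comp_id id_comp)
  have cancel_V: "inv V \<circ> W = id \<longleftrightarrow> V = W" for W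
    using iV by (metis comp_assoc comp_id id_comp)
  show ?thesis
    using cancel_U[of "synthesis_op p sY sZ j \<Psi> \<circ> analysis_op p sY j B"]
      cancel_V[of "synthesis_op p sY sZ j \<Phi> \<circ> analysis_op p sY j A"]
    by (simp add: syn analysis_op_comp comp_assoc)
qed

theorem theorem4p4:
  fixes p :: real
    and sX :: "'k::real_normed_field \<Rightarrow> 'x::banach \<Rightarrow> 'x"
    and sY :: "'k \<Rightarrow> 'y::banach \<Rightarrow> 'y"
    and sZ :: "'k \<Rightarrow> 'z::banach \<Rightarrow> 'z"
    and N :: "('k, 'y) tensor \<Rightarrow> real"
    and j :: "('k, 'y) tensor \<Rightarrow> 'z"
    and A B :: "nat \<Rightarrow> 'x \<Rightarrow> 'y"
    and \<Psi> \<Phi> :: "nat \<Rightarrow> 'y \<Rightarrow> 'x"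
  assumes "banach_over sX"
    and "lp_tensor_completion p sY N sZ j"
  shows "(p_ABS p sX sY sZ j A \<Psi> \<longrightarrow> p_ABS p sX sY sZ j B \<Phi> \<longrightarrow>
           (approx_dual_p_ABS p sX sY sZ j A \<Psi> B \<Phi> \<longleftrightarrow>
             (\<exists>U\<in>bounded_ops sX sX. \<exists>V\<in>bounded_ops sX sX.
                onorm (\<lambda>x. x - U x) < 1 \<and> onorm (\<lambda>x. x - V x) < 1 \<and>
                dual_p_ABS p sX sY sZ j A \<Psi> (\<lambda>n. B n \<circ> inv U) (\<lambda>n. inv V \<circ> \<Phi> n))))
       \<and> (p_ASF p sX sY sZ j A \<Psi> \<longrightarrow> p_ASF p sX sY sZ j B \<Phi> \<longrightarrow>
           (approx_dual_p_ASF p sX sY sZ j A \<Psi> B \<Phi> \<longleftrightarrow>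
             (\<exists>U\<in>bounded_ops sX sX. \<exists>V\<in>bounded_ops sX sX.
                onorm (\<lambda>x. x - U x) < 1 \<and> onorm (\<lambda>x. x - V x) < 1 \<and>
                dual_p_ASF p sX sY sZ j A \<Psi> (\<lambda>n. B n \<circ> inv U) (\<lambda>n. inv V \<circ> \<Phi> n))))"
proof (intro conjI impI)
  let ?\<theta> = "analysis_op p sY j" and ?\<sigma> = "synthesis_op p sY sZ j"
  assume A: "p_ABS p sX sY sZ j A \<Psi>" and B: "p_ABS p sX sY sZ j B \<Phi>"
  have ops: "?\<sigma> \<Psi> \<circ> ?\<theta> B \<in> bounded_ops sX sX" "?\<sigma> \<Phi> \<circ> ?\<theta> A \<in> bounded_ops sX sX"
    using A B by (auto simp: p_ABS_def intro: bounded_ops_comp)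
  have "dual_p_ABS p sX sY sZ j A \<Psi> (\<lambda>n. B n \<circ> inv U) (\<lambda>n. inv V \<circ> \<Phi> n) \<longleftrightarrow>
      U = ?\<sigma> \<Psi> \<circ> ?\<theta> B \<and> V = ?\<sigma> \<Phi> \<circ> ?\<theta> A"
    if "U \<in> bounded_ops sX sX" "V \<in> bounded_ops sX sX"
      "onorm (\<lambda>x. x - U x) < 1" "onorm (\<lambda>x. x - V x) < 1" for U V
    using dual_twist_iff[OF B, of U V \<Psi> A] p_ABS_twist[OF B, of "inv U" "inv V"] that A
    by (simp add: dual_p_ABS_def invertible_op_near_id invertible_op_inv)
  then have "(\<exists>U\<in>bounded_ops sX sX. \<exists>V\<in>bounded_ops sX sX.
        onorm (\<lambda>x. x - U x) < 1 \<and> onorm (\<lambda>x. x - V x) < 1 \<and>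
        dual_p_ABS p sX sY sZ j A \<Psi> (\<lambda>n. B n \<circ> inv U) (\<lambda>n. inv V \<circ> \<Phi> n)) \<longleftrightarrow>
      (\<exists>U\<in>bounded_ops sX sX. \<exists>V\<in>bounded_ops sX sX.
        onorm (\<lambda>x. x - U x) < 1 \<and> onorm (\<lambda>x. x - V x) < 1 \<and>
        U = ?\<sigma> \<Psi> \<circ> ?\<theta> B \<and> V = ?\<sigma> \<Phi> \<circ> ?\<theta> A)"
    by (intro bex_cong conj_cong refl)
  then show "approx_dual_p_ABS p sX sY sZ j A \<Psi> B \<Phi> \<longleftrightarrow>
      (\<exists>U\<in>bounded_ops sX sX. \<exists>V\<in>bounded_ops sX sX.
        onorm (\<lambda>x. x - U x) < 1 \<and> onorm (\<lambda>x. x - V x) < 1 \<and>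
        dual_p_ABS p sX sY sZ j A \<Psi> (\<lambda>n. B n \<circ> inv U) (\<lambda>n. inv V \<circ> \<Phi> n))"
    using A B ops by (auto simp: approx_dual_p_ABS_def)
next
  let ?\<theta> = "analysis_op p sY j" and ?\<sigma> = "synthesis_op p sY sZ j"
  assume A: "p_ASF p sX sY sZ j A \<Psi>" and B: "p_ASF p sX sY sZ j B \<Phi>"
  have ops: "?\<sigma> \<Psi> \<circ> ?\<theta> B \<in> bounded_ops sX sX" "?\<sigma> \<Phi> \<circ> ?\<theta> A \<in> bounded_ops sX sX"
    using A B by (auto simp: p_ASF_def p_ABS_def intro: bounded_ops_comp)
  have B': "p_ABS p sX sY sZ j B \<Phi>" using B by (simp add: p_ASF_def)
  have "dual_p_ASF p sX sY sZ j A \<Psi> (\<lambda>n. B n \<circ> inv U) (\<lambda>n. inv V \<circ> \<Phi> n) \<longleftrightarrow>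
      U = ?\<sigma> \<Psi> \<circ> ?\<theta> B \<and> V = ?\<sigma> \<Phi> \<circ> ?\<theta> A"
    if "U \<in> bounded_ops sX sX" "V \<in> bounded_ops sX sX"
      "onorm (\<lambda>x. x - U x) < 1" "onorm (\<lambda>x. x - V x) < 1" for U V
    using dual_twist_iff[OF B', of U V \<Psi> A] p_ASF_twist[OF B, of U V] that A
    by (simp add: dual_p_ASF_def invertible_op_near_id)
  then have "(\<exists>U\<in>bounded_ops sX sX. \<exists>V\<in>bounded_ops sX sX.
        onorm (\<lambda>x. x - U x) < 1 \<and> onorm (\<lambda>x. x - V x) < 1 \<and>
        dual_p_ASF p sX sY sZ j A \<Psi> (\<lambda>n. B n \<circ> inv U) (\<lambda>n. inv V \<circ> \<Phi> n)) \<longleftrightarrow>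
      (\<exists>U\<in>bounded_ops sX sX. \<exists>V\<in>bounded_ops sX sX.
        onorm (\<lambda>x. x - U x) < 1 \<and> onorm (\<lambda>x. x - V x) < 1 \<and>
        U = ?\<sigma> \<Psi> \<circ> ?\<theta> B \<and> V = ?\<sigma> \<Phi> \<circ> ?\<theta> A)"
    by (intro bex_cong conj_cong refl)
  then show "approx_dual_p_ASF p sX sY sZ j A \<Psi> B \<Phi> \<longleftrightarrow>
      (\<exists>U\<in>bounded_ops sX sX. \<exists>V\<in>bounded_ops sX sX.
        onorm (\<lambda>x. x - U x) < 1 \<and> onorm (\<lambda>x. x - V x) < 1 \<and>
        dual_p_ASF p sX sY sZ j A \<Psi> (\<lambda>n. B n \<circ> inv U) (\<lambda>n. inv V \<circ> \<Phi> n))"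
    using A B ops by (auto simp: approx_dual_p_ASF_def)
qed

end
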